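(* Let $X$ be a graph on $n$ vertices with adjacency matrix $A$, and let $A=\sum_{r=1}^m \theta_r E_r$ be the spectral decomposition of $A$ (the $\theta_r$ distinct eigenvalues, $E_r$ the orthogonal projection onto the $\theta_r$-eigenspace). The following are equivalent: (a) $X$ is 1-walk regular. (b) For every positive integer $k$ there exist scalars $a_k,b_k$ such that $A^k\circ I=a_kI$ and $A^k\circ A=b_kA$. (c) For every integer $k=1,\ldots,n-1$ there exist scalars $a_k,b_k$ such that $A^k\circ I=a_kI$ and $A^k\circ A=b_kA$. (d) For $r=1,\ldots,m$ there exist scalars $\alpha_r,\beta_r$ such that $E_r\circ I=\alpha_rI$ and $E_r\circ A=\beta_rA$. (e) There exist functions $a(t),b(t)$ such that $(tI-A)^{-1}\circ I=a(t)I$ and $(tI-A)^{-1}\circ A=b(t)A$. (f) There exist polynomials $f(t),g(t)$ such that $\operatorname{adj}(tI-A)\circ I=f(t)I$ and $\operatorname{adj}(tI-A)\circ A=g(t)A$. (g) $\phi(X\backslash u,t)$ is the same for all $u\in V(X)$, and $\phi(X\backslash\{u,v\},t)$ is the same for all pairs of adjacent vertices $u,v$ of $X$.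
   Context: A graph is walk-regular if for every positive integer $k$ the number of closed walks of length $k$ starting at a vertex is the same for all vertices; it is 1-walk regular if it is walk-regular and, for every positive integer $k$, the number of walks of length $k$ from $u$ to $v$ is the same for all pairs of adjacent vertices $u,v$. $M\circ N$ denotes the Schur (entrywise) product. $\operatorname{adj}(M)$ is the adjugate of $M$. $\phi(Y,t)=\det(tI-A(Y))$ is the characteristic polynomial of the adjacency matrix of $Y$, and for $R\subseteq V(X)$, $X\backslash R$ is the graph obtained by deleting the vertices in $R$ ($X\backslash u$ when $R=\{u\}$). *)

theory Defs
  imports
    "Graph_Theory.Arc_Walk"
    "Graph_Theory.Digraph_Component"
    "Jordan_Normal_Form.Char_Poly"
    "Jordan_Normal_Form.Gauss_Jordan_Elimination"
begin

text \<open>A simple graph is a structure satisfying the locale predicate \<open>graph\<close>: a finite symmetric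
  digraph without loops and without parallel arcs, so each edge is a pair of opposite arcs.
  Under this predicate the arc sequences counted below are in bijection with vertex sequences.\<close>

definition num_walks :: "('a, 'b) pre_digraph \<Rightarrow> nat \<Rightarrow> 'a \<Rightarrow> 'a \<Rightarrow> nat" where
  "num_walks X k u v = card {p. pre_digraph.awalk X u p v \<and> length p = k}"

definition walk_regular :: "('a, 'b) pre_digraph \<Rightarrow> bool" where
  "walk_regular X \<longleftrightarrow>
     (\<forall>k\<ge>1. \<forall>u\<in>verts X. \<forall>v\<in>verts X. num_walks X k u u = num_walks X k v v)"

definition one_walk_regular :: "('a, 'b) pre_digraph \<Rightarrow> bool" where
  "one_walk_regular X \<longleftrightarrow> walk_regular X \<and>
     (\<forall>k\<ge>1. \<forall>u v x y. u \<rightarrow>\<^bsub>X\<^esub> v \<longrightarrow> x \<rightarrow>\<^bsub>X\<^esub> y \<longrightarrow> num_walks X k u v = num_walks X k x y)"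

text \<open>Rows and columns are indexed by the positions in an arbitrary fixed listing of the vertices;
  another listing conjugates the matrix by a permutation matrix.\<close>

definition vertex_list :: "('a, 'b) pre_digraph \<Rightarrow> 'a list" where
  "vertex_list X = (SOME vs. distinct vs \<and> set vs = verts X)"

definition adjacency_matrix :: "('a, 'b) pre_digraph \<Rightarrow> real mat" where
  "adjacency_matrix X = mat (card (verts X)) (card (verts X))
     (\<lambda>(i, j). if vertex_list X ! i \<rightarrow>\<^bsub>X\<^esub> vertex_list X ! j then 1 else 0)"

definition graph_char_poly :: "('a, 'b) pre_digraph \<Rightarrow> real poly" where
  "graph_char_poly X = char_poly (adjacency_matrix X)"

definition delete_verts :: "('a, 'b) pre_digraph \<Rightarrow> 'a set \<Rightarrow> ('a, 'b) pre_digraph" where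
  "delete_verts X R = X \<restriction> (verts X - R)"

definition schur_prod :: "'a::times mat \<Rightarrow> 'a mat \<Rightarrow> 'a mat" (infixl \<open>\<circ>\<^sub>m\<close> 70) where
  "M \<circ>\<^sub>m N = mat (dim_row M) (dim_col M) (\<lambda>(i, j). M $$ (i, j) * N $$ (i, j))"

definition eigenspace :: "real mat \<Rightarrow> real \<Rightarrow> real vec set" where
  "eigenspace A \<theta> = {v \<in> carrier_vec (dim_row A). A *\<^sub>v v = \<theta> \<cdot>\<^sub>v v}"

definition orthogonal_projection :: "nat \<Rightarrow> real vec set \<Rightarrow> real mat \<Rightarrow> bool" where
  "orthogonal_projection n S P \<longleftrightarrow> P \<in> carrier_mat n n \<and>
     (\<forall>v\<in>carrier_vec n. P *\<^sub>v v \<in> S \<and> (\<forall>w\<in>S. (v - P *\<^sub>v v) \<bullet> w = 0))"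

definition spectral_decomposition ::
    "real mat \<Rightarrow> nat \<Rightarrow> (nat \<Rightarrow> real) \<Rightarrow> (nat \<Rightarrow> real mat) \<Rightarrow> bool" where
  "spectral_decomposition A m \<theta> E \<longleftrightarrow>
     inj_on \<theta> {1..m} \<and>
     \<theta> ` {1..m} = {x. eigenvalue A x} \<and>
     (\<forall>r\<in>{1..m}. orthogonal_projection (dim_row A) (eigenspace A (\<theta> r)) (E r)) \<and>
     A = mat (dim_row A) (dim_row A) (\<lambda>(i, j). \<Sum>r=1..m. \<theta> r * E r $$ (i, j))"

end

theory Submission
  imports Defs
begin

text \<open>
  Everything is read off the polynomial matrix \<open>P = adj (t I - A)\<close>. Since \<open>A E r = \<theta> r E r\<close> and
  \<open>\<Sum>r. E r = I\<close>, we have \<open>A ^ k = \<Sum>r. \<theta> r ^ k E r\<close> and \<open>P = det (t I - A) (\<Sum>r. E r / (t - \<theta> r))\<close>.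
  So two entries agree in all \<open>E r\<close> iff they agree in the powers below \<open>n\<close> (a Vandermonde system
  with at most \<open>n\<close> nodes) iff they agree in \<open>P\<close> (uniqueness of partial fractions); the resolvent
  differs from \<open>P\<close> by the scalar factor \<open>det (t I - A)\<close>.

  By Jacobi's identity the characteristic polynomial of \<open>X \ u\<close> is \<open>P u u\<close>, and that of \<open>X \ {u, v}\<close>
  times \<open>\<phi> (X, t)\<close> is \<open>P u u P v v - (P u v)\<^sup>2\<close>. Given a constant diagonal, condition (g) thus fixes
  \<open>P\<close> at edges up to sign; a sign change between two edges would negate every \<open>E r\<close> there and hence
  \<open>A = \<Sum>r. \<theta> r E r\<close>, which equals 1 at all edges.
\<close>

subsection \<open>Polynomials and distinct nodes\<close>

lemma poly_eq_if_eq_off_finite: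
  fixes p q :: "'a :: {idom, ring_char_0} poly"
  assumes "finite T" and "\<And>t. t \<notin> T \<Longrightarrow> poly p t = poly q t"
  shows "p = q"
proof (rule ccontr)
  assume "p \<noteq> q"
  then have "finite {t. poly (p - q) t = 0}" by (intro poly_roots_finite) simp
  moreover have "UNIV - T \<subseteq> {t. poly (p - q) t = 0}" using assms(2) by auto
  ultimately have "finite (UNIV - T)" by (rule rev_finite_subset)
  then show False using assms(1) infinite_UNIV_char_0[where 'a = 'a] by simp
qed

definition nodal_poly :: "('b \<Rightarrow> 'a :: idom) \<Rightarrow> 'b set \<Rightarrow> 'a poly" where
  "nodal_poly \<theta> S = (\<Prod>s\<in>S. [:- \<theta> s, 1:])"

lemma degree_nodal_poly: "degree (nodal_poly \<theta> S) = card S"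
  by (simp add: nodal_poly_def degree_prod_eq_sum_degree)

lemma poly_nodal_poly: "poly (nodal_poly \<theta> S) t = (\<Prod>s\<in>S. t - \<theta> s)"
  by (simp add: nodal_poly_def poly_prod)

lemma poly_nodal_poly_remove_eq_0_iff:
  assumes "finite R" and "inj_on \<theta> R" and "q \<in> R" "r \<in> R"
  shows "poly (nodal_poly \<theta> (R - {q})) (\<theta> r) = 0 \<longleftrightarrow> q \<noteq> r"
  using assms by (auto simp: poly_nodal_poly inj_on_eq_iff)

lemma vandermonde_trivial_kernel:
  fixes \<theta> e :: "'b \<Rightarrow> 'a :: idom"
  assumes fin: "finite R" and inj: "inj_on \<theta> R"
    and zero: "\<And>k. k < card R \<Longrightarrow> (\<Sum>s\<in>R. \<theta> s ^ k * e s) = 0"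
    and r: "r \<in> R"
  shows "e r = 0"
proof -
  let ?p = "nodal_poly \<theta> (R - {r})"
  have deg: "degree ?p < card R"
    unfolding degree_nodal_poly using fin r by (rule card_Diff1_less)
  have "0 = (\<Sum>k\<le>degree ?p. coeff ?p k * (\<Sum>s\<in>R. \<theta> s ^ k * e s))"
    using deg by (simp add: zero)
  also have "\<dots> = (\<Sum>s\<in>R. poly ?p (\<theta> s) * e s)"
    unfolding poly_altdef sum_distrib_left sum_distrib_right
    by (subst sum.swap) (simp add: mult.assoc)
  also have "\<dots> = poly ?p (\<theta> r) * e r"
  proof -
    have "poly ?p (\<theta> s) = 0" if "s \<in> R - {r}" for s
      using poly_nodal_poly_remove_eq_0_iff[OF fin inj r, of s] that by auto
    then show ?thesis by (simp add: sum.remove[OF fin r])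
  qed
  finally show ?thesis using poly_nodal_poly_remove_eq_0_iff[OF fin inj r r] by simp
qed

lemma partial_fractions_trivial_kernel:
  fixes \<theta> e :: "'b \<Rightarrow> 'a :: field_char_0"
  assumes fin: "finite R" "finite T" and inj: "inj_on \<theta> R"
    and zero: "\<And>t. t \<notin> T \<Longrightarrow> (\<Sum>s\<in>R. e s / (t - \<theta> s)) = 0"
    and r: "r \<in> R"
  shows "e r = 0"
proof -
  let ?num = "\<Sum>s\<in>R. Polynomial.smult (e s) (nodal_poly \<theta> (R - {s}))"
  have "?num = 0"
  proof (rule poly_eq_if_eq_off_finite)
    show "finite (T \<union> \<theta> ` R)" using fin by simp
    fix t assume t: "t \<notin> T \<union> \<theta> ` R"
    have "e s * poly (nodal_poly \<theta> (R - {s})) t = (\<Prod>q\<in>R. t - \<theta> q) * (e s / (t - \<theta> s))"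
      if s: "s \<in> R" for s
    proof -
      have "t \<noteq> \<theta> s" using t s by auto
      then show ?thesis by (simp add: poly_nodal_poly prod.remove[OF fin(1) s])
    qed
    then have "poly ?num t = (\<Prod>q\<in>R. t - \<theta> q) * (\<Sum>s\<in>R. e s / (t - \<theta> s))"
      by (simp add: poly_sum sum_distrib_left)
    then show "poly ?num t = poly 0 t" using zero t by simp
  qed
  then have "0 = poly ?num (\<theta> r)" by simp
  also have "\<dots> = e r * poly (nodal_poly \<theta> (R - {r})) (\<theta> r)"
  proof -
    have "poly (nodal_poly \<theta> (R - {s})) (\<theta> r) = 0" if "s \<in> R - {r}" for s
      using poly_nodal_poly_remove_eq_0_iff[OF fin(1) inj, of s r] that r by simp
    then show ?thesis by (simp add: poly_sum sum.remove[OF fin(1) r])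
  qed
  finally show ?thesis using poly_nodal_poly_remove_eq_0_iff[OF fin(1) inj r r] by simp
qed

subsection \<open>Adjugates and principal submatrices\<close>

lemma adj_mat_transpose:
  assumes M: "M \<in> carrier_mat n n"
  shows "adj_mat M\<^sup>T = (adj_mat M)\<^sup>T"
proof (rule eq_matI)
  fix i j assume "i < dim_row (adj_mat M)\<^sup>T" "j < dim_col (adj_mat M)\<^sup>T"
  then have ij: "i < n" "j < n" using adj_mat(1)[OF M] by auto
  have "mat_delete M\<^sup>T j i = (mat_delete M i j)\<^sup>T"
    using M ij by (intro eq_matI) (auto simp: mat_delete_def)
  then have "det (mat_delete M\<^sup>T j i) = det (mat_delete M i j)"
    using det_transpose[OF mat_delete_carrier[OF M]] by simp
  then show "adj_mat M\<^sup>T $$ (i, j) = (adj_mat M)\<^sup>T $$ (i, j)"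
    using M ij by (simp add: adj_mat_def cofactor_def add.commute)
qed (use M in \<open>auto simp: adj_mat_def\<close>)

lemma
  assumes M: "M \<in> carrier_mat n n" and inv: "mat_inverse M = Some B"
  shows mat_inverse_imp_det_nonzero: "det M \<noteq> 0"
    and adj_mat_eq_det_smult_mat_inverse: "adj_mat M = det M \<cdot>\<^sub>m B"
proof -
  have B: "M * B = 1\<^sub>m n" "B \<in> carrier_mat n n" using mat_inverse(2)[OF M inv] by auto
  have "det M * det B = 1" using det_mult[OF M B(2)] B(1) by simp
  then show "det M \<noteq> 0" by auto
  note adj = adj_mat[OF M]
  have "adj_mat M = adj_mat M * (M * B)" using adj(1) B by simp
  also have "\<dots> = det M \<cdot>\<^sub>m 1\<^sub>m n * B"
    using assoc_mult_mat[OF adj(1) M B(2)] adj(3) by simp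
  also have "\<dots> = det M \<cdot>\<^sub>m B" using B(2) by (simp add: mult_smult_assoc_mat[of _ n n])
  finally show "adj_mat M = det M \<cdot>\<^sub>m B" .
qed

lemma det_nonzero_imp_mat_inverse:
  assumes "M \<in> carrier_mat n n" and "det M \<noteq> 0"
  obtains B where "mat_inverse M = Some B"
  using mat_inverse(1)[OF assms(1)] det_non_zero_imp_unit[OF assms] by (metis option.exhaust)

lemma det_two_by_two:
  fixes M :: "'a :: comm_ring_1 mat"
  assumes M: "M \<in> carrier_mat 2 2"
  shows "det M = M $$ (0, 0) * M $$ (1, 1) - M $$ (0, 1) * M $$ (1, 0)"
proof -
  have minors: "det (mat_delete M 0 0) = M $$ (1, 1)" "det (mat_delete M 0 1) = M $$ (1, 0)"
    using M by (subst det_single; auto simp: mat_delete_def)+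
  have "det M = (\<Sum>j<2. M $$ (0, j) * cofactor M 0 j)"
    by (rule laplace_expansion_row[OF M]) simp
  then show ?thesis by (simp add: numeral_2_eq_2 cofactor_def minors[simplified])
qed

definition principal_submatrix :: "'a mat \<Rightarrow> nat list \<Rightarrow> 'a mat" where
  "principal_submatrix M ks = mat (length ks) (length ks) (\<lambda>(i, j). M $$ (ks ! i, ks ! j))"

lemma principal_submatrix_carrier [simp]:
  "principal_submatrix M ks \<in> carrier_mat (length ks) (length ks)"
  by (simp add: principal_submatrix_def)

lemma principal_submatrix_dim [simp]:
  "dim_row (principal_submatrix M ks) = length ks" "dim_col (principal_submatrix M ks) = length ks"
  by (simp_all add: principal_submatrix_def)

lemma principal_submatrix_index [simp]:
  "i < length ks \<Longrightarrow> j < length ks \<Longrightarrow> principal_submatrix M ks $$ (i, j) = M $$ (ks ! i, ks ! j)"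
  by (simp add: principal_submatrix_def)

lemma principal_submatrix_principal_submatrix:
  assumes "set is \<subseteq> {..<length ks}"
  shows "principal_submatrix (principal_submatrix M ks) is
    = principal_submatrix M (map ((!) ks) is)"
proof (rule eq_matI)
  fix i j assume "i < dim_row (principal_submatrix M (map ((!) ks) is))"
    "j < dim_col (principal_submatrix M (map ((!) ks) is))"
  then have ij: "i < length is" "j < length is" by auto
  then have "is ! i \<in> {..<length ks}" "is ! j \<in> {..<length ks}" using assms nth_mem by blast+
  then show "principal_submatrix (principal_submatrix M ks) is $$ (i, j)
    = principal_submatrix M (map ((!) ks) is) $$ (i, j)" using ij by simp
qed auto

lemma principal_submatrix_mult:
  assumes M: "M \<in> carrier_mat n n" and N: "N \<in> carrier_mat n n"
    and ks: "distinct ks" "set ks = {..<n}"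
  shows "principal_submatrix M ks * principal_submatrix N ks = principal_submatrix (M * N) ks"
proof (rule eq_matI)
  fix i j assume "i < dim_row (principal_submatrix (M * N) ks)"
    "j < dim_col (principal_submatrix (M * N) ks)"
  then have ij: "i < length ks" "j < length ks" by auto
  then have less: "ks ! i < n" "ks ! j < n" using ks(2) nth_mem by blast+
  have "(principal_submatrix M ks * principal_submatrix N ks) $$ (i, j)
      = (\<Sum>q<length ks. M $$ (ks ! i, ks ! q) * N $$ (ks ! q, ks ! j))"
    using ij by (simp add: scalar_prod_def atLeast0LessThan)
  also have "\<dots> = (\<Sum>q<n. M $$ (ks ! i, q) * N $$ (q, ks ! j))"
    using bij_betw_nth[OF ks(1) refl ks(2)[symmetric]] by (rule sum.reindex_bij_betw)
  also have "\<dots> = principal_submatrix (M * N) ks $$ (i, j)"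
    using ij less M N by (simp add: scalar_prod_def atLeast0LessThan)
  finally show "(principal_submatrix M ks * principal_submatrix N ks) $$ (i, j)
    = principal_submatrix (M * N) ks $$ (i, j)" .
qed auto

lemma det_principal_submatrix_permutation:
  fixes M :: "'a :: comm_ring_1 mat"
  assumes M: "M \<in> carrier_mat n n" and ks: "distinct ks" "set ks = {..<n}"
  shows "det (principal_submatrix M ks) = det M"
proof -
  have len: "length ks = n" using ks distinct_card by fastforce
  define p where "p i = (if i < n then ks ! i else i)" for i
  have "bij_betw ((!) ks) {0..<n} {0..<n}"
    using bij_betw_nth[OF ks(1) refl ks(2)[symmetric]] len by (simp add: atLeast0LessThan)
  then have "bij_betw p {0..<n} {0..<n}"
    by (rule bij_betw_cong[THEN iffD1, rotated]) (simp add: p_def)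
  then have p: "p permutes {0..<n}" by (rule bij_imp_permutes) (simp add: p_def)
  have p_less: "p i < n" if "i < n" for i using permutes_in_image[OF p, of i] that by simp
  let ?C = "mat n n (\<lambda>(i, j). M $$ (i, p j))"
  have "principal_submatrix M ks = mat n n (\<lambda>(i, j). ?C $$ (p i, j))"
    using len by (intro eq_matI) (auto simp: p_less, simp_all add: p_def)
  then have "det (principal_submatrix M ks) = signof p * det ?C"
    using det_permute_rows[OF _ p, of ?C] by simp
  also have "?C = (mat n n (\<lambda>(i, j). M\<^sup>T $$ (p i, j)))\<^sup>T"
    using M by (intro eq_matI) (auto simp: p_less)
  also have "det \<dots> = det (mat n n (\<lambda>(i, j). M\<^sup>T $$ (p i, j)))"
    by (rule det_transpose[of _ n]) simp
  also have "\<dots> = signof p * det M"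
    using det_permute_rows[OF _ p, of "M\<^sup>T"] det_transpose[OF M] M by simp
  finally show ?thesis by (cases p rule: sign_cases) simp_all
qed

text \<open>Replacing the last \<open>l\<close> columns of \<open>N\<close> by unit vectors gives a matrix \<open>C\<close> such that both \<open>C\<close>
  and \<open>M * C\<close> are block triangular.\<close>

lemma det_mult_det_leading_block:
  fixes M N :: "'a :: idom mat"
  assumes M: "M \<in> carrier_mat (k + l) (k + l)" and N: "N \<in> carrier_mat (k + l) (k + l)"
    and MN: "M * N = c \<cdot>\<^sub>m 1\<^sub>m (k + l)"
  shows "det M * det (principal_submatrix N [0..<k])
    = c ^ k * det (principal_submatrix M [k..<k + l])"
proof -
  let ?N1 = "principal_submatrix N [0..<k]" and ?N3 = "mat l k (\<lambda>(i, j). N $$ (i + k, j))"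
  let ?M2 = "mat k l (\<lambda>(i, j). M $$ (i, j + k))" and ?M4 = "principal_submatrix M [k..<k + l]"
  define C where "C = four_block_mat ?N1 (0\<^sub>m k l) ?N3 (1\<^sub>m l)"
  define D where "D = four_block_mat (c \<cdot>\<^sub>m 1\<^sub>m k) ?M2 (0\<^sub>m l k) ?M4"
  have C: "C \<in> carrier_mat (k + l) (k + l)" by (auto simp: C_def)
  have left_col: "col C j = col N j" if "j < k" for j
    using that N by (intro eq_vecI) (auto simp: C_def)
  have right_col: "col C j = unit_vec (k + l) j" if "k \<le> j" "j < k + l" for j
    using that by (intro eq_vecI) (auto simp: C_def)
  have "M * C = D"
  proof (rule eq_matI)
    fix i j assume "i < dim_row D" "j < dim_col D"
    then have ij: "i < k + l" "j < k + l" by (auto simp: D_def)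
    show "(M * C) $$ (i, j) = D $$ (i, j)"
    proof (cases "j < k")
      case True
      have "(M * C) $$ (i, j) = (M * N) $$ (i, j)"
        using ij M N C left_col[OF True] by simp
      then show ?thesis using ij True by (simp add: MN D_def)
    next
      case False
      then have "(M * C) $$ (i, j) = M $$ (i, j)"
        using ij M C right_col[of j] by simp
      then show ?thesis using ij False by (simp add: D_def)
    qed
  qed (use M C in \<open>auto simp: D_def\<close>)
  then have "det M * det C = det D" using det_mult[OF M C] by simp
  also have "det D = c ^ k * det ?M4"
    unfolding D_def by (subst det_four_block_mat_lower_left_zero[of _ k _ l]) auto
  also have "det C = det ?N1"
    unfolding C_def by (subst det_four_block_mat_upper_right_zero[of _ k _ l]) auto
  finally show ?thesis .
qed

lemma jacobi_complementary_minors: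
  fixes M :: "'a :: idom mat"
  assumes M: "M \<in> carrier_mat n n" and ks: "distinct (is @ js)" "set (is @ js) = {..<n}"
  shows "det M * det (principal_submatrix (adj_mat M) is)
    = det M ^ length is * det (principal_submatrix M js)"
proof -
  define ks where "ks = is @ js"
  define k l where "k = length is" and "l = length js"
  note ks = ks[folded ks_def]
  have len: "length ks = k + l" by (simp add: ks_def k_def l_def)
  note adj = adj_mat[OF M]
  let ?M = "principal_submatrix M ks" and ?N = "principal_submatrix (adj_mat M) ks"
  have "?M * ?N = principal_submatrix (det M \<cdot>\<^sub>m 1\<^sub>m n) ks"
    using principal_submatrix_mult[OF M adj(1) ks] adj(2) by simp
  also have "\<dots> = det M \<cdot>\<^sub>m 1\<^sub>m (k + l)"
  proof (rule eq_matI)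
    fix i j assume "i < dim_row (det M \<cdot>\<^sub>m 1\<^sub>m (k + l))" "j < dim_col (det M \<cdot>\<^sub>m 1\<^sub>m (k + l))"
    then have "i < length ks" "j < length ks" using len by auto
    moreover from this have "ks ! i < n" "ks ! j < n" using ks(2) nth_mem by blast+
    ultimately show "principal_submatrix (det M \<cdot>\<^sub>m 1\<^sub>m n) ks $$ (i, j)
        = (det M \<cdot>\<^sub>m 1\<^sub>m (k + l)) $$ (i, j)"
      using len ks(1) by (simp add: nth_eq_iff_index_eq)
  qed (auto simp: len)
  finally have "det ?M * det (principal_submatrix ?N [0..<k])
      = det M ^ k * det (principal_submatrix ?M [k..<k + l])"
    using len principal_submatrix_carrier[of _ ks] by (intro det_mult_det_leading_block) auto
  moreover have "map ((!) ks) [0..<k] = is" "map ((!) ks) [k..<k + l] = js"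
    by (auto intro!: nth_equalityI simp: ks_def k_def l_def nth_append)
  ultimately show ?thesis
    using len det_principal_submatrix_permutation[OF M ks]
    by (simp add: principal_submatrix_principal_submatrix subset_iff k_def)
qed

subsection \<open>The adjugate of the characteristic matrix\<close>

definition char_adj_mat :: "'a :: comm_ring_1 mat \<Rightarrow> 'a poly mat" where
  "char_adj_mat A = adj_mat (char_poly_matrix A)"

lemma char_adj_mat_carrier: "A \<in> carrier_mat n n \<Longrightarrow> char_adj_mat A \<in> carrier_mat n n"
  by (simp add: char_adj_mat_def adj_mat(1))

lemma poly_char_poly_matrix:
  "A \<in> carrier_mat n n \<Longrightarrow> i < n \<Longrightarrow> j < n \<Longrightarrow>
    poly (char_poly_matrix A $$ (i, j)) t = (t \<cdot>\<^sub>m 1\<^sub>m n - A) $$ (i, j)"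
  by (auto simp: char_poly_matrix_def)

lemma poly_char_poly:
  "A \<in> carrier_mat n n \<Longrightarrow> poly (char_poly A) t = det (t \<cdot>\<^sub>m 1\<^sub>m n - A)"
  unfolding char_poly_def by (rule poly_det_cong) (auto simp: poly_char_poly_matrix)

lemma poly_char_adj_mat:
  assumes A: "A \<in> carrier_mat n n" and p: "p \<in> {..<n} \<times> {..<n}"
  shows "poly (char_adj_mat A $$ p) t = adj_mat (t \<cdot>\<^sub>m 1\<^sub>m n - A) $$ p"
proof -
  let ?M = "t \<cdot>\<^sub>m 1\<^sub>m n - A" and ?P = "char_poly_matrix A"
  have M: "?M \<in> carrier_mat n n" and P: "?P \<in> carrier_mat n n" using A by auto
  obtain i j where ij: "p = (i, j)" "i < n" "j < n" using p by auto
  have "poly (det (mat_delete ?P j i)) t = det (mat_delete ?M j i)"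
  proof (rule poly_det_cong[OF mat_delete_carrier[OF M] mat_delete_carrier[OF P]])
    fix a b assume "a < n - 1" "b < n - 1"
    then show "poly (mat_delete ?P j i $$ (a, b)) t = mat_delete ?M j i $$ (a, b)"
      using carrier_matD[OF M] carrier_matD[OF P]
      by (simp add: mat_delete_def poly_char_poly_matrix[OF A] del: index_minus_mat)
  qed
  then show ?thesis
    using ij A carrier_matD[OF P] by (simp add: char_adj_mat_def adj_mat_def cofactor_def)
qed

lemma char_adj_mat_symmetric:
  assumes A: "A \<in> carrier_mat n n" "A\<^sup>T = A" and ij: "i < n" "j < n"
  shows "char_adj_mat A $$ (i, j) = char_adj_mat A $$ (j, i)"
proof -
  have "A $$ (i, j) = A $$ (j, i)" if "i < n" "j < n" for i j
    using A that by (metis carrier_matD index_transpose_mat(1))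
  then have "(char_poly_matrix A)\<^sup>T = char_poly_matrix A"
    using A(1) by (intro eq_matI) (auto simp: char_poly_matrix_def)
  then have "char_adj_mat A = (char_adj_mat A)\<^sup>T"
    using adj_mat_transpose[OF char_poly_matrix_closed[OF A(1)]] by (simp add: char_adj_mat_def)
  then show ?thesis
    using ij char_adj_mat_carrier[OF A(1)] by (metis carrier_matD index_transpose_mat(1))
qed

lemma char_poly_nonzero: "A \<in> carrier_mat n n \<Longrightarrow> char_poly A \<noteq> 0"
  using degree_monic_char_poly[of A n] by auto

lemma char_poly_matrix_principal_submatrix:
  assumes A: "A \<in> carrier_mat n n" and ks: "distinct ks" "set ks \<subseteq> {..<n}"
  shows "char_poly_matrix (principal_submatrix A ks) = principal_submatrix (char_poly_matrix A) ks"
proof (rule eq_matI)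
  fix i j assume "i < dim_row (principal_submatrix (char_poly_matrix A) ks)"
    "j < dim_col (principal_submatrix (char_poly_matrix A) ks)"
  then have ij: "i < length ks" "j < length ks" by auto
  then have less: "ks ! i < n" "ks ! j < n" using ks(2) nth_mem by blast+
  show "char_poly_matrix (principal_submatrix A ks) $$ (i, j)
      = principal_submatrix (char_poly_matrix A) ks $$ (i, j)"
    using A ij less nth_eq_iff_index_eq[OF ks(1) ij]
    by (simp add: char_poly_matrix_def)
qed (auto simp: char_poly_matrix_def)

lemma char_adj_mat_entries_eqI:
  fixes A :: "'a :: field_char_0 mat"
  assumes A: "A \<in> carrier_mat n n" and pq: "p \<in> {..<n} \<times> {..<n}" "q \<in> {..<n} \<times> {..<n}"
    and eq: "\<And>t. det (t \<cdot>\<^sub>m 1\<^sub>m n - A) \<noteq> 0 \<Longrightarrow>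
      adj_mat (t \<cdot>\<^sub>m 1\<^sub>m n - A) $$ p = adj_mat (t \<cdot>\<^sub>m 1\<^sub>m n - A) $$ q"
  shows "char_adj_mat A $$ p = char_adj_mat A $$ q"
proof (rule poly_eq_if_eq_off_finite)
  show "finite {t. poly (char_poly A) t = 0}"
    by (rule poly_roots_finite[OF char_poly_nonzero[OF A]])
qed (use eq in \<open>simp add: poly_char_adj_mat[OF A] pq poly_char_poly[OF A]\<close>)

subsection \<open>Schur products with the identity and with a fixed matrix\<close>

definition mat_support :: "'a :: zero mat \<Rightarrow> (nat \<times> nat) set" where
  "mat_support A = {(i, j). i < dim_row A \<and> j < dim_col A \<and> A $$ (i, j) \<noteq> 0}"

definition schur_pairs :: "'a :: zero mat \<Rightarrow> ((nat \<times> nat) \<times> nat \<times> nat) set" where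
  "schur_pairs A =
    Id_on {..<dim_row A} \<times> Id_on {..<dim_row A} \<union> mat_support A \<times> mat_support A"

definition schur_regular :: "'a :: zero mat \<Rightarrow> 'b mat \<Rightarrow> bool" where
  "schur_regular A M \<longleftrightarrow> (\<forall>(p, q)\<in>schur_pairs A. M $$ p = M $$ q)"

lemma schur_regularD: "schur_regular A M \<Longrightarrow> (p, q) \<in> schur_pairs A \<Longrightarrow> M $$ p = M $$ q"
  by (auto simp: schur_regular_def)

lemma schur_pairs_index:
  assumes "A \<in> carrier_mat n n" and "(p, q) \<in> schur_pairs A"
  shows "p \<in> {..<n} \<times> {..<n}" "q \<in> {..<n} \<times> {..<n}"
  using assms by (auto simp: schur_pairs_def mat_support_def)

lemma schur_regular_iff_constant:
  "schur_regular A M \<longleftrightarrow>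
    (\<exists>a b. (\<forall>p\<in>Id_on {..<dim_row A}. M $$ p = a) \<and> (\<forall>p\<in>mat_support A. M $$ p = b))"
    (is "_ \<longleftrightarrow> (\<exists>a b. ?D a \<and> ?S b)")
proof
  assume reg: "schur_regular A M"
  then have "\<exists>a. ?D a" by (metis SigmaI UnI1 schur_pairs_def schur_regularD)
  moreover have "\<exists>b. ?S b" using reg by (metis SigmaI UnI2 schur_pairs_def schur_regularD)
  ultimately show "\<exists>a b. ?D a \<and> ?S b" by blast
next
  assume "\<exists>a b. ?D a \<and> ?S b"
  then obtain a b where "?D a" "?S b" by blast
  then have "M $$ p = M $$ q" if "(p, q) \<in> schur_pairs A" for p q
    using that unfolding schur_pairs_def by (elim UnE SigmaE2) metis+
  then show "schur_regular A M" by (auto simp: schur_regular_def)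
qed

lemma schur_regular_iff_pairwise:
  "schur_regular A M \<longleftrightarrow>
    (\<forall>p\<in>Id_on {..<dim_row A}. \<forall>q\<in>Id_on {..<dim_row A}. M $$ p = M $$ q) \<and>
    (\<forall>p\<in>mat_support A. \<forall>q\<in>mat_support A. M $$ p = M $$ q)"
  unfolding schur_regular_def schur_pairs_def by blast

lemma schur_prod_one_iff:
  fixes M :: "'a :: comm_ring_1 mat"
  assumes "M \<in> carrier_mat n n"
  shows "M \<circ>\<^sub>m 1\<^sub>m n = a \<cdot>\<^sub>m 1\<^sub>m n \<longleftrightarrow> (\<forall>p\<in>Id_on {..<n}. M $$ p = a)"
  using assms by (auto simp: mat_eq_iff schur_prod_def)

lemma schur_prod_smult_iff:
  fixes M :: "'a :: idom mat"
  assumes "A \<in> carrier_mat n n" and "M \<in> carrier_mat n n"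
  shows "M \<circ>\<^sub>m A = b \<cdot>\<^sub>m A \<longleftrightarrow> (\<forall>p\<in>mat_support A. M $$ p = b)"
  using assms by (auto simp: mat_eq_iff schur_prod_def mat_support_def)

lemma schur_regular_iff:
  fixes A M :: "'a :: idom mat"
  assumes "A \<in> carrier_mat n n" and "M \<in> carrier_mat n n"
  shows "schur_regular A M \<longleftrightarrow> (\<exists>a b. M \<circ>\<^sub>m 1\<^sub>m n = a \<cdot>\<^sub>m 1\<^sub>m n \<and> M \<circ>\<^sub>m A = b \<cdot>\<^sub>m A)"
  using assms
  by (simp add: schur_regular_iff_constant schur_prod_one_iff schur_prod_smult_iff)

lemma schur_regular_one:
  assumes "A \<in> carrier_mat n n" and "\<And>i. i < n \<Longrightarrow> A $$ (i, i) = 0"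
  shows "schur_regular A (1\<^sub>m n)"
  using assms by (auto simp: schur_regular_def schur_pairs_def mat_support_def)

lemma schur_regular_char_adj_mat_iff_resolvent:
  fixes A :: "'a :: field_char_0 mat"
  assumes A: "A \<in> carrier_mat n n"
  shows "schur_regular A (char_adj_mat A) \<longleftrightarrow>
    (\<forall>t B. mat_inverse (t \<cdot>\<^sub>m 1\<^sub>m n - A) = Some B \<longrightarrow> schur_regular A B)"
proof -
  have shift: "t \<cdot>\<^sub>m 1\<^sub>m n - A \<in> carrier_mat n n" for t using A by auto
  have adj: "adj_mat (t \<cdot>\<^sub>m 1\<^sub>m n - A) $$ p = det (t \<cdot>\<^sub>m 1\<^sub>m n - A) * B $$ p"
    if "mat_inverse (t \<cdot>\<^sub>m 1\<^sub>m n - A) = Some B" "p \<in> {..<n} \<times> {..<n}" for t B p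
    using that mat_inverse(2)[OF shift that(1)] adj_mat_eq_det_smult_mat_inverse[OF shift that(1)]
    by auto
  show ?thesis
  proof (intro iffI allI impI)
    fix t B assume reg: "schur_regular A (char_adj_mat A)"
      and B: "mat_inverse (t \<cdot>\<^sub>m 1\<^sub>m n - A) = Some B"
    have "B $$ p = B $$ q" if pq: "(p, q) \<in> schur_pairs A" for p q
    proof -
      note index = schur_pairs_index[OF A pq]
      have "det (t \<cdot>\<^sub>m 1\<^sub>m n - A) * B $$ p = det (t \<cdot>\<^sub>m 1\<^sub>m n - A) * B $$ q"
        using schur_regularD[OF reg pq] poly_char_adj_mat[OF A] index adj[OF B] by metis
      then show ?thesis using mat_inverse_imp_det_nonzero[OF shift B] by simp
    qed
    then show "schur_regular A B" by (auto simp: schur_regular_def)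
  next
    assume res: "\<forall>t B. mat_inverse (t \<cdot>\<^sub>m 1\<^sub>m n - A) = Some B \<longrightarrow> schur_regular A B"
    have "char_adj_mat A $$ p = char_adj_mat A $$ q" if pq: "(p, q) \<in> schur_pairs A" for p q
    proof (rule char_adj_mat_entries_eqI[OF A])
      show "p \<in> {..<n} \<times> {..<n}" "q \<in> {..<n} \<times> {..<n}" using schur_pairs_index[OF A pq] by auto
      fix t assume "det (t \<cdot>\<^sub>m 1\<^sub>m n - A) \<noteq> 0"
      then obtain B where B: "mat_inverse (t \<cdot>\<^sub>m 1\<^sub>m n - A) = Some B"
        by (rule det_nonzero_imp_mat_inverse[OF shift])
      then have "B $$ p = B $$ q" using res pq schur_regularD by metis
      then show "adj_mat (t \<cdot>\<^sub>m 1\<^sub>m n - A) $$ p = adj_mat (t \<cdot>\<^sub>m 1\<^sub>m n - A) $$ q"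
        using adj[OF B] schur_pairs_index[OF A pq] by simp
    qed
    then show "schur_regular A (char_adj_mat A)" by (auto simp: schur_regular_def)
  qed
qed

lemma schur_regular_char_adj_mat_iff_ex_poly:
  fixes A :: "'a :: field_char_0 mat"
  assumes A: "A \<in> carrier_mat n n"
  shows "schur_regular A (char_adj_mat A) \<longleftrightarrow>
    (\<exists>f g. \<forall>t. adj_mat (t \<cdot>\<^sub>m 1\<^sub>m n - A) \<circ>\<^sub>m 1\<^sub>m n = poly f t \<cdot>\<^sub>m 1\<^sub>m n \<and>
      adj_mat (t \<cdot>\<^sub>m 1\<^sub>m n - A) \<circ>\<^sub>m A = poly g t \<cdot>\<^sub>m A)"
proof -
  have adj: "adj_mat (t \<cdot>\<^sub>m 1\<^sub>m n - A) \<in> carrier_mat n n" for t using A by (intro adj_mat(1)) auto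
  have const_iff: "(\<forall>p\<in>S. char_adj_mat A $$ p = f) \<longleftrightarrow>
      (\<forall>t. \<forall>p\<in>S. adj_mat (t \<cdot>\<^sub>m 1\<^sub>m n - A) $$ p = poly f t)" if S: "S \<subseteq> {..<n} \<times> {..<n}" for S f
  proof -
    have "char_adj_mat A $$ p = f \<longleftrightarrow> (\<forall>t. adj_mat (t \<cdot>\<^sub>m 1\<^sub>m n - A) $$ p = poly f t)"
      if "p \<in> S" for p
      using poly_char_adj_mat[OF A subsetD[OF S that]]
      by (simp add: poly_eq_poly_eq_iff[symmetric] fun_eq_iff)
    then show ?thesis by auto
  qed
  have "Id_on {..<n} \<subseteq> {..<n} \<times> {..<n}" "mat_support A \<subseteq> {..<n} \<times> {..<n}"
    using A by (auto simp: mat_support_def)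
  then show ?thesis
    unfolding schur_regular_iff_constant schur_prod_one_iff[OF adj] schur_prod_smult_iff[OF A adj]
      carrier_matD(1)[OF A] all_conj_distrib
    by (simp only: const_iff)
qed

lemma schur_regular_char_adj_mat_iff_ex_resolvent:
  fixes A :: "'a :: field_char_0 mat"
  assumes A: "A \<in> carrier_mat n n"
  shows "schur_regular A (char_adj_mat A) \<longleftrightarrow>
    (\<exists>a b. \<forall>t B. mat_inverse (t \<cdot>\<^sub>m 1\<^sub>m n - A) = Some B \<longrightarrow>
      B \<circ>\<^sub>m 1\<^sub>m n = a t \<cdot>\<^sub>m 1\<^sub>m n \<and> B \<circ>\<^sub>m A = b t \<cdot>\<^sub>m A)"
    (is "_ \<longleftrightarrow> (\<exists>a b. \<forall>t B. ?inv t B \<longrightarrow> ?scalars B (a t) (b t))")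
proof -
  have shift: "t \<cdot>\<^sub>m 1\<^sub>m n - A \<in> carrier_mat n n" for t using A by auto
  have "B \<in> carrier_mat n n" if "?inv t B" for t B
    using mat_inverse(2)[OF shift that] by blast
  then have "schur_regular A (char_adj_mat A) \<longleftrightarrow>
      (\<forall>t B. ?inv t B \<longrightarrow> (\<exists>a b. ?scalars B a b))"
    unfolding schur_regular_char_adj_mat_iff_resolvent[OF A] using schur_regular_iff[OF A] by meson
  also have "\<dots> \<longleftrightarrow> (\<forall>t. \<exists>a b. \<forall>B. ?inv t B \<longrightarrow> ?scalars B a b)"
  proof (rule all_cong1)
    show "(\<forall>B. ?inv t B \<longrightarrow> (\<exists>a b. ?scalars B a b)) \<longleftrightarrow>
        (\<exists>a b. \<forall>B. ?inv t B \<longrightarrow> ?scalars B a b)" for t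
      by (cases "mat_inverse (t \<cdot>\<^sub>m 1\<^sub>m n - A)") auto
  qed
  also have "\<dots> \<longleftrightarrow> (\<exists>a b. \<forall>t B. ?inv t B \<longrightarrow> ?scalars B (a t) (b t))"
    by (simp only: choice_iff)
  finally show ?thesis .
qed

subsection \<open>Spectral resolutions\<close>

definition mat_sum :: "nat \<Rightarrow> 'r set \<Rightarrow> ('r \<Rightarrow> 'a :: comm_monoid_add mat) \<Rightarrow> 'a mat" where
  "mat_sum n R E = mat n n (\<lambda>(i, j). \<Sum>r\<in>R. E r $$ (i, j))"

lemma mat_sum_carrier [simp]: "mat_sum n R E \<in> carrier_mat n n"
  by (simp add: mat_sum_def)

lemma mat_sum_dim [simp]: "dim_row (mat_sum n R E) = n" "dim_col (mat_sum n R E) = n"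
  by (simp_all add: mat_sum_def)

lemma mat_sum_index [simp]:
  "i < n \<Longrightarrow> j < n \<Longrightarrow> mat_sum n R E $$ (i, j) = (\<Sum>r\<in>R. E r $$ (i, j))"
  by (simp add: mat_sum_def)

lemma mult_mat_sum:
  fixes B :: "'a :: semiring_0 mat"
  assumes B: "B \<in> carrier_mat n n" and E: "\<And>r. r \<in> R \<Longrightarrow> E r \<in> carrier_mat n n"
  shows "B * mat_sum n R E = mat_sum n R (\<lambda>r. B * E r)"
proof (rule eq_matI)
  fix i j assume "i < dim_row (mat_sum n R (\<lambda>r. B * E r))" "j < dim_col (mat_sum n R (\<lambda>r. B * E r))"
  then have ij: "i < n" "j < n" by (auto simp: mat_sum_def)
  have "(B * mat_sum n R E) $$ (i, j) = (\<Sum>k<n. \<Sum>r\<in>R. B $$ (i, k) * E r $$ (k, j))"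
    using B ij by (simp add: mat_sum_def scalar_prod_def atLeast0LessThan sum_distrib_left)
  also have "\<dots> = (\<Sum>r\<in>R. \<Sum>k<n. B $$ (i, k) * E r $$ (k, j))" by (rule sum.swap)
  also have "\<dots> = (\<Sum>r\<in>R. (B * E r) $$ (i, j))"
  proof (intro sum.cong refl)
    fix r assume "r \<in> R"
    then show "(\<Sum>k<n. B $$ (i, k) * E r $$ (k, j)) = (B * E r) $$ (i, j)"
      using B E[of r] ij by (simp add: scalar_prod_def atLeast0LessThan)
  qed
  finally show "(B * mat_sum n R E) $$ (i, j) = mat_sum n R (\<lambda>r. B * E r) $$ (i, j)"
    using ij by simp
qed (use B in \<open>auto simp: mat_sum_def\<close>)

lemma col_mat_sum_scalar_prod:
  fixes w :: "'a :: semiring_0 vec"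
  assumes E: "\<And>r. r \<in> R \<Longrightarrow> E r \<in> carrier_mat n n" and w: "w \<in> carrier_vec n" and j: "j < n"
  shows "col (mat_sum n R E) j \<bullet> w = (\<Sum>r\<in>R. col (E r) j \<bullet> w)"
proof -
  have "col (mat_sum n R E) j \<bullet> w = (\<Sum>k<n. \<Sum>r\<in>R. E r $$ (k, j) * w $ k)"
    using w j by (simp add: mat_sum_def scalar_prod_def atLeast0LessThan sum_distrib_right)
  also have "\<dots> = (\<Sum>r\<in>R. \<Sum>k<n. E r $$ (k, j) * w $ k)" by (rule sum.swap)
  also have "\<dots> = (\<Sum>r\<in>R. col (E r) j \<bullet> w)"
  proof (intro sum.cong refl)
    fix r assume "r \<in> R"
    then show "(\<Sum>k<n. E r $$ (k, j) * w $ k) = col (E r) j \<bullet> w"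
      using E[of r] w j by (simp add: scalar_prod_def atLeast0LessThan)
  qed
  finally show ?thesis .
qed

locale spectral_resolution =
  fixes A :: "'a :: field_char_0 mat" and n :: nat
    and R :: "'r set" and \<theta> :: "'r \<Rightarrow> 'a" and E :: "'r \<Rightarrow> 'a mat"
  assumes carrier: "A \<in> carrier_mat n n"
    and finite_index: "finite R"
    and inj_theta: "inj_on \<theta> R"
    and eigenvalue_theta: "r \<in> R \<Longrightarrow> eigenvalue A (\<theta> r)"
    and component_carrier: "r \<in> R \<Longrightarrow> E r \<in> carrier_mat n n"
    and mult_component: "r \<in> R \<Longrightarrow> A * E r = \<theta> r \<cdot>\<^sub>m E r"
    and sum_components: "mat_sum n R E = 1\<^sub>m n"
begin

lemma card_index_le: "card R \<le> n"
proof -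
  have "card (\<theta> ` R) \<le> card {x. poly (char_poly A) x = 0}"
    using eigenvalue_theta eigenvalue_root_char_poly[OF carrier]
    by (intro card_mono poly_roots_finite[OF char_poly_nonzero[OF carrier]]) auto
  also have "\<dots> \<le> n"
    using card_poly_roots_bound[OF char_poly_nonzero[OF carrier]] degree_monic_char_poly[OF carrier]
    by simp
  finally show ?thesis by (simp add: card_image[OF inj_theta])
qed

lemma index_eq_sum_components:
  assumes B: "B \<in> carrier_mat n n" and eigen: "\<And>r. r \<in> R \<Longrightarrow> B * E r = c r \<cdot>\<^sub>m E r"
    and p: "p \<in> {..<n} \<times> {..<n}"
  shows "B $$ p = (\<Sum>r\<in>R. c r * E r $$ p)"
proof -
  obtain i j where ij: "p = (i, j)" "i < n" "j < n" using p by auto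
  have "B = B * mat_sum n R E" using B by (simp add: sum_components)
  also have "\<dots> = mat_sum n R (\<lambda>r. B * E r)"
    by (rule mult_mat_sum[OF B component_carrier])
  finally have "B $$ (i, j) = (\<Sum>r\<in>R. (B * E r) $$ (i, j))" using ij by (metis mat_sum_index)
  also have "\<dots> = (\<Sum>r\<in>R. c r * E r $$ (i, j))"
  proof (intro sum.cong refl)
    fix r assume "r \<in> R"
    then show "(B * E r) $$ (i, j) = c r * E r $$ (i, j)"
      using eigen component_carrier[of r] ij by simp
  qed
  finally show ?thesis using ij by simp
qed

lemma pow_mult_component:
  assumes r: "r \<in> R"
  shows "A ^\<^sub>m k * E r = \<theta> r ^ k \<cdot>\<^sub>m E r"
proof (induction k)
  case 0
  then show ?case using carrier component_carrier[OF r] by auto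
next
  case (Suc k)
  note E = component_carrier[OF r]
  have Ak: "A ^\<^sub>m k \<in> carrier_mat n n" using carrier by simp
  have "A ^\<^sub>m Suc k * E r = A ^\<^sub>m k * (\<theta> r \<cdot>\<^sub>m E r)"
    using assoc_mult_mat[OF Ak carrier E] by (simp add: mult_component[OF r])
  also have "\<dots> = \<theta> r \<cdot>\<^sub>m (\<theta> r ^ k \<cdot>\<^sub>m E r)"
    using mult_smult_distrib[OF Ak E] Suc by simp
  also have "\<dots> = \<theta> r ^ Suc k \<cdot>\<^sub>m E r"
    by (intro eq_matI) (auto simp: mult.assoc)
  finally show ?case .
qed

lemmas pow_index = index_eq_sum_components[OF pow_carrier_mat[OF carrier] pow_mult_component]

lemma adj_mult_component:
  assumes r: "r \<in> R" and t: "t \<noteq> \<theta> r"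
  shows "adj_mat (t \<cdot>\<^sub>m 1\<^sub>m n - A) * E r = (det (t \<cdot>\<^sub>m 1\<^sub>m n - A) / (t - \<theta> r)) \<cdot>\<^sub>m E r"
proof -
  let ?M = "t \<cdot>\<^sub>m 1\<^sub>m n - A"
  note E = component_carrier[OF r]
  have M: "?M \<in> carrier_mat n n" using carrier by auto
  note adj = adj_mat[OF M]
  have "?M * E r = t \<cdot>\<^sub>m 1\<^sub>m n * E r - A * E r"
    using carrier E by (intro minus_mult_distrib_mat[of _ n n]) auto
  then have shift: "?M * E r = (t - \<theta> r) \<cdot>\<^sub>m E r"
    using E by (simp add: mult_component[OF r] mult_smult_assoc_mat[of _ n n])
      (auto simp: left_diff_distrib intro!: eq_matI)
  let ?P = "adj_mat ?M * E r"
  have P: "?P \<in> carrier_mat n n" using adj(1) E by simp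
  have "(t - \<theta> r) \<cdot>\<^sub>m ?P = adj_mat ?M * (?M * E r)"
    using mult_smult_distrib[OF adj(1) E] by (simp only: shift)
  also have "\<dots> = det ?M \<cdot>\<^sub>m E r"
    using assoc_mult_mat[OF adj(1) M E] adj(3) E by (simp add: mult_smult_assoc_mat[of _ n n])
  finally have scaled: "(t - \<theta> r) \<cdot>\<^sub>m ?P = det ?M \<cdot>\<^sub>m E r" .
  show ?thesis
  proof (rule eq_matI)
    fix i j assume "i < dim_row ((det ?M / (t - \<theta> r)) \<cdot>\<^sub>m E r)"
      "j < dim_col ((det ?M / (t - \<theta> r)) \<cdot>\<^sub>m E r)"
    then have ij: "i < n" "j < n" using E by auto
    then have "(t - \<theta> r) * ?P $$ (i, j) = det ?M * E r $$ (i, j)"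
      using arg_cong[OF scaled, of "\<lambda>M. M $$ (i, j)"] carrier_matD[OF P] E
      by (simp del: index_mult_mat(1))
    then show "?P $$ (i, j) = ((det ?M / (t - \<theta> r)) \<cdot>\<^sub>m E r) $$ (i, j)"
      using t ij E by (simp add: field_simps del: index_mult_mat(1))
  qed (use P E in auto)
qed

lemma poly_char_adj_mat_index:
  assumes t: "t \<notin> \<theta> ` R" and p: "p \<in> {..<n} \<times> {..<n}"
  shows "poly (char_adj_mat A $$ p) t =
    det (t \<cdot>\<^sub>m 1\<^sub>m n - A) * (\<Sum>r\<in>R. E r $$ p / (t - \<theta> r))"
proof -
  have "adj_mat (t \<cdot>\<^sub>m 1\<^sub>m n - A) $$ p
      = (\<Sum>r\<in>R. det (t \<cdot>\<^sub>m 1\<^sub>m n - A) / (t - \<theta> r) * E r $$ p)"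
    using t carrier by (intro index_eq_sum_components[OF _ _ p] adj_mat(1) adj_mult_component) auto
  then show ?thesis by (simp add: poly_char_adj_mat[OF carrier p] sum_distrib_left)
qed

lemma component_entries_eqI:
  assumes p: "p \<in> {..<n} \<times> {..<n}" and q: "q \<in> {..<n} \<times> {..<n}"
    and eq: "\<And>k. k < n \<Longrightarrow> (A ^\<^sub>m k) $$ p = (A ^\<^sub>m k) $$ q" and r: "r \<in> R"
  shows "E r $$ p = E r $$ q"
proof -
  have "E r $$ p - E r $$ q = 0"
  proof (rule vandermonde_trivial_kernel[OF finite_index inj_theta _ r])
    fix k assume "k < card R"
    then have "(A ^\<^sub>m k) $$ p = (A ^\<^sub>m k) $$ q" using eq card_index_le by simp
    then show "(\<Sum>s\<in>R. \<theta> s ^ k * (E s $$ p - E s $$ q)) = 0"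
      by (simp add: pow_index[OF _ p] pow_index[OF _ q] right_diff_distrib sum_subtractf)
  qed
  then show ?thesis by simp
qed

lemma char_adj_mat_entries_smult_iff:
  assumes p: "p \<in> {..<n} \<times> {..<n}" and q: "q \<in> {..<n} \<times> {..<n}"
  shows "char_adj_mat A $$ p = Polynomial.smult c (char_adj_mat A $$ q) \<longleftrightarrow>
    (\<forall>r\<in>R. E r $$ p = c * E r $$ q)"
proof
  let ?D = "\<lambda>t. det (t \<cdot>\<^sub>m 1\<^sub>m n - A)"
  let ?T = "\<theta> ` R \<union> {t. poly (char_poly A) t = 0}"
  have fin: "finite ?T"
    using finite_index poly_roots_finite[OF char_poly_nonzero[OF carrier]] by simp
  show "\<forall>r\<in>R. E r $$ p = c * E r $$ q"
    if eq: "char_adj_mat A $$ p = Polynomial.smult c (char_adj_mat A $$ q)"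
  proof -
    have "E r $$ p - c * E r $$ q = 0" if r: "r \<in> R" for r
    proof (rule partial_fractions_trivial_kernel[OF finite_index fin inj_theta _ r])
      fix t assume t: "t \<notin> ?T"
      then have "t \<notin> \<theta> ` R" by simp
      note index = poly_char_adj_mat_index[OF this]
      have "?D t * (\<Sum>s\<in>R. (E s $$ p - c * E s $$ q) / (t - \<theta> s)) = 0"
        using arg_cong[OF eq, of "\<lambda>f. poly f t"]
        by (simp add: index p q diff_divide_distrib sum_subtractf
            right_diff_distrib sum_distrib_left mult_ac)
      moreover have "?D t \<noteq> 0" using t poly_char_poly[OF carrier, of t] by simp
      ultimately show "(\<Sum>s\<in>R. (E s $$ p - c * E s $$ q) / (t - \<theta> s)) = 0" by simp
    qed
    then show ?thesis by simp
  qed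
  show "char_adj_mat A $$ p = Polynomial.smult c (char_adj_mat A $$ q)"
    if "\<forall>r\<in>R. E r $$ p = c * E r $$ q"
  proof (rule poly_eq_if_eq_off_finite[OF fin])
    fix t assume "t \<notin> ?T"
    then have "t \<notin> \<theta> ` R" by simp
    note index = poly_char_adj_mat_index[OF this]
    show "poly (char_adj_mat A $$ p) t = poly (Polynomial.smult c (char_adj_mat A $$ q)) t"
      using that by (simp add: index p q sum_distrib_left mult_ac)
  qed
qed

lemma char_adj_mat_entries_eq_uminusD:
  assumes p: "p \<in> {..<n} \<times> {..<n}" and q: "q \<in> {..<n} \<times> {..<n}"
    and eq: "char_adj_mat A $$ p = - char_adj_mat A $$ q"
  shows "A $$ p = - A $$ q"
proof -
  note A_index = index_eq_sum_components[OF carrier mult_component]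
  have "\<forall>r\<in>R. E r $$ p = - 1 * E r $$ q"
    using char_adj_mat_entries_smult_iff[OF p q, of "- 1"] eq by simp
  then show ?thesis by (simp add: A_index p q sum_negf)
qed

lemma schur_regular_components_iff_char_adj_mat:
  assumes B: "B \<in> carrier_mat n n"
  shows "(\<forall>r\<in>R. schur_regular B (E r)) \<longleftrightarrow> schur_regular B (char_adj_mat A)"
proof -
  have "(\<forall>r\<in>R. E r $$ p = E r $$ q) \<longleftrightarrow> char_adj_mat A $$ p = char_adj_mat A $$ q"
    if "(p, q) \<in> schur_pairs B" for p q
    using char_adj_mat_entries_smult_iff[OF schur_pairs_index[OF B that], of 1] by simp
  then show ?thesis unfolding schur_regular_def by fast
qed

lemma schur_regular_pow:
  assumes B: "B \<in> carrier_mat n n" and reg: "\<forall>r\<in>R. schur_regular B (E r)"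
  shows "schur_regular B (A ^\<^sub>m k)"
proof -
  have "(A ^\<^sub>m k) $$ p = (A ^\<^sub>m k) $$ q" if pq: "(p, q) \<in> schur_pairs B" for p q
  proof -
    have "E r $$ p = E r $$ q" if "r \<in> R" for r
      by (rule schur_regularD[OF bspec[OF reg that] pq])
    then show ?thesis
      by (simp add: pow_index schur_pairs_index[OF B pq])
  qed
  then show ?thesis by (auto simp: schur_regular_def)
qed

lemma schur_regular_componentI:
  assumes B: "B \<in> carrier_mat n n" and reg: "\<And>k. k < n \<Longrightarrow> schur_regular B (A ^\<^sub>m k)"
    and r: "r \<in> R"
  shows "schur_regular B (E r)"
proof -
  have "E r $$ p = E r $$ q" if pq: "(p, q) \<in> schur_pairs B" for p q
    by (rule component_entries_eqI[OF schur_pairs_index[OF B pq] schur_regularD[OF reg pq] r])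
  then show ?thesis by (auto simp: schur_regular_def)
qed

lemma schur_regular_pow_iff_components:
  assumes zero_diag: "\<And>i. i < n \<Longrightarrow> A $$ (i, i) = 0"
  shows "(\<forall>k\<ge>1. schur_regular A (A ^\<^sub>m k)) \<longleftrightarrow> (\<forall>r\<in>R. schur_regular A (E r))"
    and "(\<forall>k\<in>{1..n - 1}. schur_regular A (A ^\<^sub>m k)) \<longleftrightarrow> (\<forall>r\<in>R. schur_regular A (E r))"
proof -
  have components: "\<forall>r\<in>R. schur_regular A (E r)"
    if reg: "\<forall>k\<in>{1..n - 1}. schur_regular A (A ^\<^sub>m k)"
  proof (intro ballI schur_regular_componentI[OF carrier])
    fix k assume "k < n"
    show "schur_regular A (A ^\<^sub>m k)"
    proof (cases k)
      case 0
      then show ?thesis using schur_regular_one[OF carrier zero_diag] carrier by simp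
    next
      case (Suc l)
      then have "k \<in> {1..n - 1}" using \<open>k < n\<close> by simp
      then show ?thesis using reg by blast
    qed
  qed
  then show "(\<forall>k\<ge>1. schur_regular A (A ^\<^sub>m k)) \<longleftrightarrow> (\<forall>r\<in>R. schur_regular A (E r))"
    using schur_regular_pow[OF carrier] by (metis atLeastAtMost_iff)
  show "(\<forall>k\<in>{1..n - 1}. schur_regular A (A ^\<^sub>m k)) \<longleftrightarrow> (\<forall>r\<in>R. schur_regular A (E r))"
    using components schur_regular_pow[OF carrier] by blast
qed

end

lemma symmetric_eigenspaces_orthogonal:
  assumes A: "A \<in> carrier_mat n n" "A\<^sup>T = A"
    and v: "v \<in> eigenspace A x" and w: "w \<in> eigenspace A y" and "x \<noteq> y"
  shows "v \<bullet> w = 0"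
proof -
  have vw: "v \<in> carrier_vec n" "w \<in> carrier_vec n" using v w A(1) by (auto simp: eigenspace_def)
  have "(A *\<^sub>v v) \<bullet> w = v \<bullet> (A *\<^sub>v w)"
    using transpose_vec_mult_scalar[OF A(1) vw(2,1)] A(2) by simp
  then have "x * (v \<bullet> w) = y * (v \<bullet> w)"
    using v w vw by (auto simp: eigenspace_def)
  with \<open>x \<noteq> y\<close> show ?thesis by simp
qed

lemma
  assumes P: "orthogonal_projection n S P" and j: "j < n"
  shows orthogonal_projection_col_mem: "col P j \<in> S"
    and orthogonal_projection_col_scalar_prod: "w \<in> S \<Longrightarrow> w \<in> carrier_vec n \<Longrightarrow> col P j \<bullet> w = w $ j"
proof -
  have Pc: "P \<in> carrier_mat n n" using P by (simp add: orthogonal_projection_def)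
  have col: "P *\<^sub>v unit_vec n j = col P j" using Pc j by (intro eq_vecI) auto
  show "col P j \<in> S"
    using P unit_vec_carrier[of n j] by (auto simp: orthogonal_projection_def col[symmetric])
  assume w: "w \<in> S" "w \<in> carrier_vec n"
  have "(unit_vec n j - col P j) \<bullet> w = 0"
    using P w(1) unit_vec_carrier[of n j] by (auto simp: orthogonal_projection_def col[symmetric])
  then show "col P j \<bullet> w = w $ j"
    using minus_scalar_prod_distrib[of "unit_vec n j" n "col P j" w] w(2) Pc j by auto
qed

context
  fixes A :: "real mat" and n m :: nat and \<theta> :: "nat \<Rightarrow> real" and E :: "nat \<Rightarrow> real mat"
  assumes A: "A \<in> carrier_mat n n" and symmetric: "A\<^sup>T = A"
    and decomposition: "spectral_decomposition A m \<theta> E"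
begin

lemma spectral_projection: "r \<in> {1..m} \<Longrightarrow> orthogonal_projection n (eigenspace A (\<theta> r)) (E r)"
  using decomposition carrier_matD(1)[OF A] by (metis spectral_decomposition_def)

lemma
  shows inj_spectral_values: "inj_on \<theta> {1..m}"
    and spectral_values_image: "\<theta> ` {1..m} = {x. eigenvalue A x}"
  using decomposition unfolding spectral_decomposition_def by blast+

lemma spectral_decomposition_index:
  assumes "i < n" "j < n"
  shows "A $$ (i, j) = (\<Sum>r=1..m. \<theta> r * E r $$ (i, j))"
proof -
  have "A = mat (dim_row A) (dim_row A) (\<lambda>(i, j). \<Sum>r=1..m. \<theta> r * E r $$ (i, j))"
    using decomposition unfolding spectral_decomposition_def by blast
  from arg_cong[OF this, of "\<lambda>M. M $$ (i, j)"] show ?thesis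
    using assms carrier_matD(1)[OF A] by simp
qed

lemma spectral_projection_carrier: "r \<in> {1..m} \<Longrightarrow> E r \<in> carrier_mat n n"
  using spectral_projection by (simp add: orthogonal_projection_def)

lemma mult_spectral_projection:
  assumes r: "r \<in> {1..m}"
  shows "A * E r = \<theta> r \<cdot>\<^sub>m E r"
proof (rule mat_col_eqI)
  note E = spectral_projection_carrier[OF r]
  fix j assume "j < dim_col (\<theta> r \<cdot>\<^sub>m E r)"
  then have j: "j < n" using E by simp
  have "col (A * E r) j = A *\<^sub>v col (E r) j" using A E j by (intro eq_vecI) auto
  also have "\<dots> = \<theta> r \<cdot>\<^sub>v col (E r) j"
    using orthogonal_projection_col_mem[OF spectral_projection[OF r] j]
    by (simp add: eigenspace_def)
  finally show "col (A * E r) j = col (\<theta> r \<cdot>\<^sub>m E r) j" using E j by simp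
qed (use A spectral_projection_carrier[OF r] in auto)

lemma mult_sum_spectral_projections: "A * mat_sum n {1..m} E = A"
proof (rule eq_matI)
  fix i j assume "i < dim_row A" "j < dim_col A"
  then have ij: "i < n" "j < n" using A by auto
  have "(A * mat_sum n {1..m} E) $$ (i, j) = (\<Sum>r=1..m. (A * E r) $$ (i, j))"
    using mult_mat_sum[of A n "{1..m}" E, OF A spectral_projection_carrier] ij by simp
  also have "\<dots> = (\<Sum>r=1..m. \<theta> r * E r $$ (i, j))"
  proof (intro sum.cong refl)
    fix r assume "r \<in> {1..m}"
    then show "(A * E r) $$ (i, j) = \<theta> r * E r $$ (i, j)"
      using mult_spectral_projection[of r] spectral_projection_carrier[of r] ij by simp
  qed
  also have "\<dots> = A $$ (i, j)" using spectral_decomposition_index ij by simp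
  finally show "(A * mat_sum n {1..m} E) $$ (i, j) = A $$ (i, j)" .
qed (use A in \<open>auto simp: mat_sum_def\<close>)

lemma col_sum_spectral_projections_kernel:
  assumes w: "w \<in> eigenspace A 0" and j: "j < n"
  shows "col (mat_sum n {1..m} E) j \<bullet> w = w $ j"
proof (cases "w = 0\<^sub>v n")
  case True
  then show ?thesis using j by (simp add: mat_sum_def)
next
  case False
  have wc: "w \<in> carrier_vec n" using w A by (simp add: eigenspace_def)
  have "eigenvalue A 0"
    using False w A by (auto simp: eigenvalue_def eigenvector_def eigenspace_def)
  then obtain r where r: "r \<in> {1..m}" "\<theta> r = 0"
    using spectral_values_image by (metis image_iff mem_Collect_eq)
  have "col (mat_sum n {1..m} E) j \<bullet> w = (\<Sum>q=1..m. col (E q) j \<bullet> w)"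
    by (rule col_mat_sum_scalar_prod[OF spectral_projection_carrier wc j])
  also have "\<dots> = (\<Sum>q=1..m. if q = r then w $ j else 0)"
  proof (intro sum.cong refl)
    fix q assume q: "q \<in> {1..m}"
    show "col (E q) j \<bullet> w = (if q = r then w $ j else 0)"
    proof (cases "q = r")
      case True
      then show ?thesis
        using orthogonal_projection_col_scalar_prod[OF spectral_projection[OF q] j] w wc r by simp
    next
      case False
      then have "\<theta> q \<noteq> 0"
        using r q inj_spectral_values by (metis inj_on_def)
      then show ?thesis
        using orthogonal_projection_col_mem[OF spectral_projection[OF q] j] False
          symmetric_eigenspaces_orthogonal[OF A symmetric _ w] by simp
    qed
  qed
  also have "\<dots> = w $ j" using r by simp
  finally show ?thesis .
qed

text \<open>A column of \<open>1 - \<Sum>r. E r\<close> lies in the kernel of \<open>A\<close> and is orthogonal to it.\<close>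

lemma sum_spectral_projections: "mat_sum n {1..m} E = 1\<^sub>m n"
proof (rule mat_col_eqI)
  let ?S = "mat_sum n {1..m} E"
  fix j assume "j < dim_col (1\<^sub>m n :: real mat)"
  then have j: "j < n" by simp
  have S: "col ?S j \<in> carrier_vec n" by (rule col_carrier_vec[OF j mat_sum_carrier])
  define w where "w = unit_vec n j - col ?S j"
  have w: "w \<in> carrier_vec n" using S by (simp add: w_def)
  have "A *\<^sub>v col ?S j = col A j"
    using mult_sum_spectral_projections col_mult2[OF A mat_sum_carrier j] by metis
  moreover have "A *\<^sub>v unit_vec n j = col A j" using A j by (intro eq_vecI) auto
  ultimately have "A *\<^sub>v w = 0\<^sub>v n"
    using A S j by (simp add: w_def mult_minus_distrib_mat_vec[of _ n n] minus_cancel_vec[of _ n])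
  then have kernel: "w \<in> eigenspace A 0" using A w by (auto simp: eigenspace_def)
  have "w \<bullet> w = unit_vec n j \<bullet> w - col ?S j \<bullet> w"
    using minus_scalar_prod_distrib[of "unit_vec n j" n "col ?S j" w] S w by (simp add: w_def)
  also have "\<dots> = 0"
    using col_sum_spectral_projections_kernel[OF kernel j] S w j by simp
  finally have "w = 0\<^sub>v n"
    using conjugate_square_eq_0_vec[OF w] by (simp add: conjugate_vec_def)
  show "col ?S j = col (1\<^sub>m n) j"
  proof (rule eq_vecI)
    fix i assume "i < dim_vec (col (1\<^sub>m n) j :: real vec)"
    then have i: "i < n" by simp
    then have "w $ i = 0" using \<open>w = 0\<^sub>v n\<close> by simp
    then show "col ?S j $ i = col (1\<^sub>m n) j $ i"
      using i j S by (simp add: w_def)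
  qed (use S in simp)
qed (simp_all add: mat_sum_def)

lemma spectral_resolution_of_symmetric: "spectral_resolution A n {1..m} \<theta> E"
proof
  show "inj_on \<theta> {1..m}" "\<And>r. r \<in> {1..m} \<Longrightarrow> eigenvalue A (\<theta> r)"
    using inj_spectral_values spectral_values_image by auto
qed (simp_all only: A spectral_projection_carrier mult_spectral_projection sum_spectral_projections
    finite_atLeastAtMost)

end

subsection \<open>Adjacency matrices\<close>

lemma
  assumes "finite (verts G)"
  shows distinct_vertex_list: "distinct (vertex_list G)"
    and set_vertex_list: "set (vertex_list G) = verts G"
proof -
  have "\<exists>vs. distinct vs \<and> set vs = verts G" using finite_distinct_list[OF assms] by auto
  from someI_ex[OF this] show "distinct (vertex_list G)" "set (vertex_list G) = verts G"
    by (simp_all add: vertex_list_def)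
qed

lemma length_vertex_list: "finite (verts G) \<Longrightarrow> length (vertex_list G) = card (verts G)"
  using distinct_vertex_list set_vertex_list distinct_card by metis

lemma bij_betw_vertex_list:
  "finite (verts G) \<Longrightarrow> bij_betw ((!) (vertex_list G)) {..<card (verts G)} (verts G)"
  by (intro bij_betw_nth) (auto simp: distinct_vertex_list set_vertex_list length_vertex_list)

lemma vertex_list_position:
  assumes "finite (verts G)" and "u \<in> verts G"
  obtains i where "i < card (verts G)" "vertex_list G ! i = u"
  using assms by (metis in_set_conv_nth set_vertex_list length_vertex_list)

lemma adjacency_matrix_carrier: "adjacency_matrix G \<in> carrier_mat (card (verts G)) (card (verts G))"
  by (simp add: adjacency_matrix_def)

lemma adjacency_matrix_index:
  "i < card (verts G) \<Longrightarrow> j < card (verts G) \<Longrightarrow>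
    adjacency_matrix G $$ (i, j) = (if vertex_list G ! i \<rightarrow>\<^bsub>G\<^esub> vertex_list G ! j then 1 else 0)"
  by (simp add: adjacency_matrix_def)

context graph
begin

lemma adjacency_matrix_symmetric: "(adjacency_matrix G)\<^sup>T = adjacency_matrix G"
  using adjacency_matrix_carrier[of G]
  by (intro eq_matI) (auto simp: adjacency_matrix_index graph_symmetric)

lemma adjacency_matrix_diag: "i < card (verts G) \<Longrightarrow> adjacency_matrix G $$ (i, i) = 0"
  by (auto simp: adjacency_matrix_index arcs_ends_conv dest: no_loops)

lemma arcs_ends_eq_image_mat_support:
  "arcs_ends G =
    map_prod ((!) (vertex_list G)) ((!) (vertex_list G)) ` mat_support (adjacency_matrix G)"
  (is "_ = ?h ` ?S")
proof (intro equalityI subsetI)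
  fix e assume "e \<in> arcs_ends G"
  then obtain u v where e: "e = (u, v)" "u \<rightarrow> v" by (cases e) auto
  then have "u \<in> verts G" "v \<in> verts G" using adj_in_verts by auto
  then obtain i j where "i < card (verts G)" "vertex_list G ! i = u"
    "j < card (verts G)" "vertex_list G ! j = v"
    using vertex_list_position[OF finite_verts] by metis
  moreover from this have "(i, j) \<in> ?S"
    using e adjacency_matrix_carrier[of G] by (auto simp: mat_support_def adjacency_matrix_index)
  ultimately show "e \<in> ?h ` ?S" using e by force
next
  fix e assume "e \<in> ?h ` ?S"
  then show "e \<in> arcs_ends G"
    using adjacency_matrix_carrier[of G]
    by (auto simp: mat_support_def adjacency_matrix_index split: if_splits)
qed

lemma schur_regular_adjacency_matrix_iff:
  assumes M: "\<And>i j. i < card (verts G) \<Longrightarrow> j < card (verts G) \<Longrightarrow>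
    M $$ (i, j) = f (vertex_list G ! i) (vertex_list G ! j)"
  shows "schur_regular (adjacency_matrix G) M \<longleftrightarrow>
    (\<forall>u\<in>verts G. \<forall>v\<in>verts G. f u u = f v v) \<and>
    (\<forall>u v x y. u \<rightarrow> v \<longrightarrow> x \<rightarrow> y \<longrightarrow> f u v = f x y)"
proof -
  let ?n = "card (verts G)" and ?A = "adjacency_matrix G" and ?vs = "(!) (vertex_list G)"
  have image: "?vs ` {..<?n} = verts G"
    using bij_betw_vertex_list[OF finite_verts] by (simp add: bij_betw_def)
  have ball_verts: "(\<forall>u\<in>verts G. Q u) \<longleftrightarrow> (\<forall>i\<in>{..<?n}. Q (?vs i))" for Q
    by (subst image[symmetric]) simp
  have diag: "(\<forall>u\<in>verts G. \<forall>v\<in>verts G. f u u = f v v) \<longleftrightarrow>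
      (\<forall>p\<in>Id_on {..<?n}. \<forall>q\<in>Id_on {..<?n}. M $$ p = M $$ q)"
    by (simp add: ball_verts M Id_on_def)
  have supp: "M $$ p = case_prod f (map_prod ?vs ?vs p)" if "p \<in> mat_support ?A" for p
    using that adjacency_matrix_carrier[of G] by (auto simp: mat_support_def M)
  have "(\<forall>u v x y. u \<rightarrow> v \<longrightarrow> x \<rightarrow> y \<longrightarrow> f u v = f x y) \<longleftrightarrow>
      (\<forall>e\<in>arcs_ends G. \<forall>e'\<in>arcs_ends G. case_prod f e = case_prod f e')"
    by auto
  also have "\<dots> \<longleftrightarrow> (\<forall>p\<in>mat_support ?A. \<forall>q\<in>mat_support ?A. M $$ p = M $$ q)"
    unfolding arcs_ends_eq_image_mat_support by (simp add: supp)
  finally show ?thesis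
    unfolding schur_regular_iff_pairwise diag using adjacency_matrix_carrier[of G] by simp
qed

end

subsection \<open>Walks\<close>

lemma pow_mat_Suc_left:
  fixes M :: "'a :: semiring_1 mat"
  assumes M: "M \<in> carrier_mat n n"
  shows "M ^\<^sub>m Suc k = M * M ^\<^sub>m k"
proof (induction k)
  case (Suc k)
  have "M ^\<^sub>m Suc (Suc k) = (M * M ^\<^sub>m k) * M" using Suc by simp
  also have "\<dots> = M * (M ^\<^sub>m k * M)" using M by (intro assoc_mult_mat) auto
  finally show ?case by simp
qed (use M in simp)

context graph
begin

lemma finite_awalks_of_length: "finite {p. awalk u p v \<and> length p = k}"
  by (rule finite_subset[OF _ finite_lists_length_eq[OF finite_arcs, of k]]) (auto simp: awalk_def)

lemma num_walks_0: "u \<in> verts G \<Longrightarrow> num_walks G 0 u v = (if u = v then 1 else 0)"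
  by (auto simp: num_walks_def awalk_Nil_iff cong: conj_cong)

lemma num_walks_Suc:
  assumes "u \<in> verts G"
  shows "num_walks G (Suc k) u v = (\<Sum>w\<in>{w \<in> verts G. u \<rightarrow> w}. num_walks G k w v)"
proof -
  let ?W = "\<lambda>k u. {p. awalk u p v \<and> length p = k}"
  let ?out = "{e \<in> arcs G. tail G e = u}"
  have "?W (Suc k) u = (\<Union>e\<in>?out. (#) e ` ?W k (head G e))"
    by (auto simp: length_Suc_conv awalk_Cons_iff)
  then have "num_walks G (Suc k) u v = card (\<Union>e\<in>?out. (#) e ` ?W k (head G e))"
    by (simp add: num_walks_def)
  also have "\<dots> = (\<Sum>e\<in>?out. card ((#) e ` ?W k (head G e)))"
    by (rule card_UN_disjoint) (auto simp: finite_awalks_of_length)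
  also have "\<dots> = (\<Sum>e\<in>?out. num_walks G k (head G e) v)"
    by (simp add: card_image num_walks_def)
  also have "\<dots> = (\<Sum>w\<in>head G ` ?out. num_walks G k w v)"
    using no_multi_arcs by (subst sum.reindex) (auto simp: inj_on_def arc_to_ends_def)
  also have "head G ` ?out = {w \<in> verts G. u \<rightarrow> w}"
    by (auto simp: arcs_ends_conv)
  finally show ?thesis .
qed

lemma pow_adjacency_matrix_index:
  assumes "i < card (verts G)" and j: "j < card (verts G)"
  shows "(adjacency_matrix G ^\<^sub>m k) $$ (i, j)
    = real (num_walks G k (vertex_list G ! i) (vertex_list G ! j))"
  using assms(1)
proof (induction k arbitrary: i)
  case 0
  have "vertex_list G ! i = vertex_list G ! j \<longleftrightarrow> i = j"
    using 0 j by (intro nth_eq_iff_index_eq) (auto simp: distinct_vertex_list length_vertex_list)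
  moreover have "vertex_list G ! i \<in> verts G"
    using 0 bij_betw_vertex_list[OF finite_verts] by (auto simp: bij_betw_def)
  ultimately show ?case using 0 j adjacency_matrix_carrier[of G] by (simp add: num_walks_0)
next
  case (Suc k)
  let ?n = "card (verts G)" and ?vs = "vertex_list G" and ?A = "adjacency_matrix G"
  note bij = bij_betw_vertex_list[OF finite_verts]
  have i: "?vs ! i \<in> verts G" using bij Suc.prems by (auto simp: bij_betw_def)
  have "(?A ^\<^sub>m Suc k) $$ (i, j) = (\<Sum>q<?n. ?A $$ (i, q) * (?A ^\<^sub>m k) $$ (q, j))"
    unfolding pow_mat_Suc_left[OF adjacency_matrix_carrier]
    using Suc.prems j adjacency_matrix_carrier[of G]
    by (simp add: scalar_prod_def atLeast0LessThan)
  also have "\<dots> = (\<Sum>q<?n. if ?vs ! i \<rightarrow> ?vs ! q then real (num_walks G k (?vs ! q) (?vs ! j)) else 0)"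
    using Suc.prems by (intro sum.cong refl) (simp add: adjacency_matrix_index Suc.IH)
  also have "\<dots> = (\<Sum>w\<in>verts G. if ?vs ! i \<rightarrow> w then real (num_walks G k w (?vs ! j)) else 0)"
    by (rule sum.reindex_bij_betw[OF bij])
  also have "\<dots> = real (num_walks G (Suc k) (?vs ! i) (?vs ! j))"
    by (simp add: num_walks_Suc[OF i] sum.inter_filter if_distrib[of real] cong: if_cong)
  finally show ?case .
qed

lemma one_walk_regular_iff_schur_regular_pow:
  "one_walk_regular G \<longleftrightarrow>
    (\<forall>k\<ge>1. schur_regular (adjacency_matrix G) (adjacency_matrix G ^\<^sub>m k))"
proof -
  have "schur_regular (adjacency_matrix G) (adjacency_matrix G ^\<^sub>m k) \<longleftrightarrow>
      (\<forall>u\<in>verts G. \<forall>v\<in>verts G. real (num_walks G k u u) = real (num_walks G k v v)) \<and>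
      (\<forall>u v x y. u \<rightarrow> v \<longrightarrow> x \<rightarrow> y \<longrightarrow> real (num_walks G k u v) = real (num_walks G k x y))" for k
    by (rule schur_regular_adjacency_matrix_iff) (rule pow_adjacency_matrix_index)
  then show ?thesis unfolding one_walk_regular_def walk_regular_def of_nat_eq_iff by blast
qed

end

subsection \<open>Vertex-deleted subgraphs\<close>

lemma dominates_induce_subgraph_iff:
  "u \<rightarrow>\<^bsub>G \<restriction> S\<^esub> v \<longleftrightarrow> u \<rightarrow>\<^bsub>G\<^esub> v \<and> u \<in> S \<and> v \<in> S"
  by (auto simp: arcs_ends_conv)

lemma adjacency_matrix_induce_subgraph:
  assumes fin: "finite S" and positions: "set ks \<subseteq> {..<card (verts G)}"
    and listing: "map ((!) (vertex_list G)) ks = vertex_list (G \<restriction> S)"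
  shows "adjacency_matrix (G \<restriction> S) = principal_submatrix (adjacency_matrix G) ks"
proof (rule eq_matI)
  let ?H = "G \<restriction> S"
  have finH: "finite (verts ?H)" using fin by simp
  have len: "length ks = card (verts ?H)"
    using arg_cong[OF listing, of length] length_vertex_list[OF finH] by simp
  fix i j assume "i < dim_row (principal_submatrix (adjacency_matrix G) ks)"
    "j < dim_col (principal_submatrix (adjacency_matrix G) ks)"
  then have ij: "i < length ks" "j < length ks" by auto
  then have less: "ks ! i < card (verts G)" "ks ! j < card (verts G)"
    using positions nth_mem by blast+
  have nth: "vertex_list ?H ! q = vertex_list G ! (ks ! q)" if "q < length ks" for q
    using that by (simp add: listing[symmetric])
  have "vertex_list ?H ! q \<in> S" if "q < length ks" for q
    using bij_betw_apply[OF bij_betw_vertex_list[OF finH], of q] that len by simp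
  then show "adjacency_matrix ?H $$ (i, j) = principal_submatrix (adjacency_matrix G) ks $$ (i, j)"
    using ij less len nth by (auto simp: adjacency_matrix_index dominates_induce_subgraph_iff)
qed (use length_vertex_list[of "G \<restriction> S"] arg_cong[OF listing, of length] fin
    in \<open>simp_all add: adjacency_matrix_def\<close>)

lemma adjacency_matrix_delete_verts:
  assumes fin: "finite (verts G)" and ks: "distinct ks" "set ks \<subseteq> {..<card (verts G)}"
  obtains js where "distinct (ks @ js)" "set (ks @ js) = {..<card (verts G)}"
    "adjacency_matrix (delete_verts G ((!) (vertex_list G) ` set ks))
      = principal_submatrix (adjacency_matrix G) js"
proof
  let ?n = "card (verts G)" and ?vs = "(!) (vertex_list G)"
  define S where "S = verts G - ?vs ` set ks"
  define pos where "pos = inv_into {..<?n} ?vs"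
  define js where "js = map pos (vertex_list (G \<restriction> S))"
  note bij = bij_betw_vertex_list[OF fin]
  have finS: "finite S" using fin by (simp add: S_def)
  then have S_list: "distinct (vertex_list (G \<restriction> S))" "set (vertex_list (G \<restriction> S)) = S"
    by (simp_all add: distinct_vertex_list set_vertex_list)
  have S: "S = ?vs ` ({..<?n} - set ks)"
    using bij ks(2) by (simp add: S_def bij_betw_def inj_on_image_set_diff[of ?vs "{..<?n}"])
  have pos: "?vs (pos v) = v" if "v \<in> S" for v
    unfolding pos_def using that by (intro bij_betw_inv_into_right[OF bij]) (simp add: S_def)
  have "inj_on pos S" using pos by (metis inj_on_inverseI)
  then have dist_js: "distinct js" by (simp add: js_def distinct_map S_list)
  have "set js = pos ` S" by (simp add: js_def S_list)
  also have "\<dots> = {..<?n} - set ks"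
    using bij_betw_inv_into_left[OF bij] by (simp add: S pos_def image_image)
  finally have set_js: "set js = {..<?n} - set ks" .
  then show "distinct (ks @ js)" "set (ks @ js) = {..<?n}" using dist_js ks by auto
  have listing: "map ?vs js = vertex_list (G \<restriction> S)"
    unfolding js_def map_map by (rule map_idI) (simp add: S_list pos)
  have "set js \<subseteq> {..<?n}" using set_js by blast
  from adjacency_matrix_induce_subgraph[OF finS this listing]
  show "adjacency_matrix (delete_verts G (?vs ` set ks))
      = principal_submatrix (adjacency_matrix G) js"
    by (simp add: delete_verts_def S_def)
qed

lemma graph_char_poly_delete_verts:
  assumes "finite (verts G)" and "distinct ks" "set ks \<subseteq> {..<card (verts G)}"
  shows "graph_char_poly G * det (principal_submatrix (char_adj_mat (adjacency_matrix G)) ks)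
    = graph_char_poly G ^ length ks *
      graph_char_poly (delete_verts G ((!) (vertex_list G) ` set ks))"
proof -
  note A = adjacency_matrix_carrier[of G]
  obtain js where js: "distinct (ks @ js)" "set (ks @ js) = {..<card (verts G)}"
    and del: "adjacency_matrix (delete_verts G ((!) (vertex_list G) ` set ks))
      = principal_submatrix (adjacency_matrix G) js"
    using adjacency_matrix_delete_verts[OF assms] .
  have "char_poly_matrix (principal_submatrix (adjacency_matrix G) js)
      = principal_submatrix (char_poly_matrix (adjacency_matrix G)) js"
    using js by (intro char_poly_matrix_principal_submatrix[OF A]) auto
  then show ?thesis
    using jacobi_complementary_minors[OF char_poly_matrix_closed[OF A] js]
    by (simp add: graph_char_poly_def char_poly_def char_adj_mat_def del)
qed

text \<open>Since \<open>{u, u} = {u}\<close>, the diagonal records the deletion of single vertices.\<close>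

definition deletion_matrix :: "('a, 'b) pre_digraph \<Rightarrow> real poly mat" where
  "deletion_matrix G = mat (card (verts G)) (card (verts G))
    (\<lambda>(i, j). graph_char_poly (delete_verts G {vertex_list G ! i, vertex_list G ! j}))"

lemma graph_char_poly_nonzero: "graph_char_poly G \<noteq> 0"
  unfolding graph_char_poly_def by (rule char_poly_nonzero[OF adjacency_matrix_carrier])

lemma deletion_matrix_diag:
  assumes fin: "finite (verts G)" and i: "i < card (verts G)"
  shows "deletion_matrix G $$ (i, i) = char_adj_mat (adjacency_matrix G) $$ (i, i)"
proof -
  have "det (principal_submatrix (char_adj_mat (adjacency_matrix G)) [i])
      = char_adj_mat (adjacency_matrix G) $$ (i, i)"
    by (subst det_single) (simp_all add: principal_submatrix_def)
  then show ?thesis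
    using graph_char_poly_delete_verts[OF fin, of "[i]"] i graph_char_poly_nonzero[of G]
    by (simp add: deletion_matrix_def)
qed

context graph
begin

lemma deletion_matrix_off_diag:
  assumes ij: "i < card (verts G)" "j < card (verts G)" "i \<noteq> j"
  defines "P \<equiv> char_adj_mat (adjacency_matrix G)"
  shows "graph_char_poly G * deletion_matrix G $$ (i, j)
    = P $$ (i, i) * P $$ (j, j) - (P $$ (i, j))\<^sup>2"
proof -
  have "P $$ (j, i) = P $$ (i, j)"
    unfolding P_def
    by (rule char_adj_mat_symmetric[OF adjacency_matrix_carrier adjacency_matrix_symmetric ij(2,1)])
  then have "det (principal_submatrix P [i, j]) = P $$ (i, i) * P $$ (j, j) - (P $$ (i, j))\<^sup>2"
    by (subst det_two_by_two) (auto simp: principal_submatrix_def power2_eq_square numeral_2_eq_2)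
  moreover have "graph_char_poly G * det (principal_submatrix P [i, j])
      = graph_char_poly G * (graph_char_poly G * deletion_matrix G $$ (i, j))"
    using graph_char_poly_delete_verts[of G "[i, j]"] ij
    by (simp add: deletion_matrix_def P_def mult.assoc)
  ultimately show ?thesis using graph_char_poly_nonzero[of G] by simp
qed

lemma schur_regular_deletion_matrix_iff:
  assumes "spectral_resolution (adjacency_matrix G) (card (verts G)) R \<theta> E"
  shows "schur_regular (adjacency_matrix G) (deletion_matrix G) \<longleftrightarrow>
    schur_regular (adjacency_matrix G) (char_adj_mat (adjacency_matrix G))"
proof -
  interpret spectral_resolution "adjacency_matrix G" "card (verts G)" R \<theta> E by fact
  let ?A = "adjacency_matrix G" and ?n = "card (verts G)" and ?D = "deletion_matrix G"
  let ?P = "char_adj_mat ?A"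
  have diag: "?D $$ p = ?P $$ p" if "p \<in> Id_on {..<?n}" for p
    using that by (auto simp: deletion_matrix_diag)
  have edges: "?D $$ p = ?D $$ q \<longleftrightarrow> ?P $$ p = ?P $$ q"
    if reg: "\<forall>p\<in>Id_on {..<?n}. \<forall>q\<in>Id_on {..<?n}. ?P $$ p = ?P $$ q"
      and p: "p \<in> mat_support ?A" and q: "q \<in> mat_support ?A" for p q
  proof -
    have edge: "i < ?n" "j < ?n" "i \<noteq> j" "?A $$ (i, j) = 1" if "(i, j) \<in> mat_support ?A" for i j
      using that adjacency_matrix_carrier[of G] adjacency_matrix_diag[of i]
      by (auto simp: mat_support_def adjacency_matrix_index split: if_splits)
    obtain i j k l where pq: "p = (i, j)" "q = (k, l)" by (metis surj_pair)
    note ij = edge[OF p[unfolded pq]] and kl = edge[OF q[unfolded pq]]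
    have "?P $$ (i, i) = ?P $$ (k, k)" "?P $$ (j, j) = ?P $$ (l, l)"
      using reg ij kl by (auto simp: Id_on_iff)
    then have "graph_char_poly G * ?D $$ p = graph_char_poly G * ?D $$ q \<longleftrightarrow>
        (?P $$ p)\<^sup>2 = (?P $$ q)\<^sup>2"
      unfolding pq using ij kl by (simp add: deletion_matrix_off_diag)
    moreover have "?P $$ p \<noteq> - ?P $$ q"
      using char_adj_mat_entries_eq_uminusD[of p q] ij kl unfolding pq by auto
    ultimately show ?thesis using graph_char_poly_nonzero[of G] by (auto simp: power2_eq_iff)
  qed
  have dim: "dim_row ?A = ?n" using adjacency_matrix_carrier[of G] by auto
  have "(\<forall>p\<in>Id_on {..<?n}. \<forall>q\<in>Id_on {..<?n}. ?D $$ p = ?D $$ q) \<longleftrightarrow>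
      (\<forall>p\<in>Id_on {..<?n}. \<forall>q\<in>Id_on {..<?n}. ?P $$ p = ?P $$ q)"
    by (simp add: diag)
  then show ?thesis
    unfolding schur_regular_iff_pairwise dim by (rule conj_cong) (intro ball_cong refl edges)
qed

lemma schur_regular_deletion_matrix_iff_char_polys:
  "schur_regular (adjacency_matrix G) (deletion_matrix G) \<longleftrightarrow>
    (\<forall>u\<in>verts G. \<forall>v\<in>verts G.
      graph_char_poly (delete_verts G {u}) = graph_char_poly (delete_verts G {v})) \<and>
    (\<forall>u v x y. u \<rightarrow> v \<longrightarrow> x \<rightarrow> y \<longrightarrow>
      graph_char_poly (delete_verts G {u, v}) = graph_char_poly (delete_verts G {x, y}))"
  by (subst schur_regular_adjacency_matrix_iff
        [of _ "\<lambda>u v. graph_char_poly (delete_verts G {u, v})"])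
    (simp_all add: deletion_matrix_def)

end

theorem theorem2p1:
  fixes X :: "('a, 'b) pre_digraph" and n m :: nat and A :: "real mat"
    and \<theta> :: "nat \<Rightarrow> real" and E :: "nat \<Rightarrow> real mat"
  assumes "graph X"
    and "n = card (verts X)"
    and "A = adjacency_matrix X"
    and "spectral_decomposition A m \<theta> E"
  shows
    "(one_walk_regular X \<longleftrightarrow>
        (\<forall>k\<ge>1. \<exists>a b :: real. (A ^\<^sub>m k) \<circ>\<^sub>m 1\<^sub>m n = a \<cdot>\<^sub>m 1\<^sub>m n \<and> (A ^\<^sub>m k) \<circ>\<^sub>m A = b \<cdot>\<^sub>m A)) \<and>
     (one_walk_regular X \<longleftrightarrow>
        (\<forall>k\<in>{1..n - 1}. \<exists>a b :: real. (A ^\<^sub>m k) \<circ>\<^sub>m 1\<^sub>m n = a \<cdot>\<^sub>m 1\<^sub>m n \<and> (A ^\<^sub>m k) \<circ>\<^sub>m A = b \<cdot>\<^sub>m A)) \<and>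
     (one_walk_regular X \<longleftrightarrow>
        (\<forall>r\<in>{1..m}. \<exists>\<alpha> \<beta> :: real. E r \<circ>\<^sub>m 1\<^sub>m n = \<alpha> \<cdot>\<^sub>m 1\<^sub>m n \<and> E r \<circ>\<^sub>m A = \<beta> \<cdot>\<^sub>m A)) \<and>
     (one_walk_regular X \<longleftrightarrow>
        (\<exists>a b :: real \<Rightarrow> real. \<forall>t B. mat_inverse (t \<cdot>\<^sub>m 1\<^sub>m n - A) = Some B \<longrightarrow>
           B \<circ>\<^sub>m 1\<^sub>m n = a t \<cdot>\<^sub>m 1\<^sub>m n \<and> B \<circ>\<^sub>m A = b t \<cdot>\<^sub>m A)) \<and>
     (one_walk_regular X \<longleftrightarrow>
        (\<exists>f g :: real poly. \<forall>t.
           adj_mat (t \<cdot>\<^sub>m 1\<^sub>m n - A) \<circ>\<^sub>m 1\<^sub>m n = poly f t \<cdot>\<^sub>m 1\<^sub>m n \<and>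
           adj_mat (t \<cdot>\<^sub>m 1\<^sub>m n - A) \<circ>\<^sub>m A = poly g t \<cdot>\<^sub>m A)) \<and>
     (one_walk_regular X \<longleftrightarrow>
        (\<forall>u\<in>verts X. \<forall>v\<in>verts X.
           graph_char_poly (delete_verts X {u}) = graph_char_poly (delete_verts X {v})) \<and>
        (\<forall>u v x y. u \<rightarrow>\<^bsub>X\<^esub> v \<longrightarrow> x \<rightarrow>\<^bsub>X\<^esub> y \<longrightarrow>
           graph_char_poly (delete_verts X {u, v}) = graph_char_poly (delete_verts X {x, y})))"
proof -
  interpret graph X by fact
  have A: "A \<in> carrier_mat n n" using assms adjacency_matrix_carrier by simp
  interpret spectral_resolution A n "{1..m}" \<theta> E
    using spectral_resolution_of_symmetric A adjacency_matrix_symmetric assms by simp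
  let ?scalars = "\<lambda>M a b. M \<circ>\<^sub>m 1\<^sub>m n = a \<cdot>\<^sub>m 1\<^sub>m n \<and> M \<circ>\<^sub>m A = b \<cdot>\<^sub>m A"
  have scalars: "schur_regular A M \<longleftrightarrow> (\<exists>a b. ?scalars M a b)" if "M \<in> carrier_mat n n" for M
    by (rule schur_regular_iff[OF A that])
  have loopless: "A $$ (i, i) = 0" if "i < n" for i using adjacency_matrix_diag that assms by simp
  have regular: "one_walk_regular X \<longleftrightarrow> schur_regular A (char_adj_mat A)"
    using one_walk_regular_iff_schur_regular_pow schur_regular_pow_iff_components(1)[OF loopless]
      schur_regular_components_iff_char_adj_mat[OF A] assms by simp
  note powers = schur_regular_pow_iff_components[OF loopless,
      unfolded schur_regular_components_iff_char_adj_mat[OF A] scalars[OF pow_carrier_mat[OF A]]]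
  have projections: "(\<forall>r\<in>{1..m}. \<exists>\<alpha> \<beta>. ?scalars (E r) \<alpha> \<beta>) \<longleftrightarrow> schur_regular A (char_adj_mat A)"
    using schur_regular_components_iff_char_adj_mat[OF A] scalars[OF component_carrier] by simp
  note resolvent = schur_regular_char_adj_mat_iff_ex_resolvent[OF A, symmetric]
    and adjugate = schur_regular_char_adj_mat_iff_ex_poly[OF A, symmetric]
  have "schur_regular A (deletion_matrix X) \<longleftrightarrow> schur_regular A (char_adj_mat A)"
    using schur_regular_deletion_matrix_iff spectral_resolution_axioms assms by simp
  note deletions = this[unfolded assms(3) schur_regular_deletion_matrix_iff_char_polys,
      folded assms(3)]
  show ?thesis
    by (simp only: regular powers projections resolvent adjugate deletions simp_thms)
qed

end
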